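(* For each $N$, let $\omega_1,\dots,\omega_N$ be independent identically distributed Gaussian random variables with mean zero and unit variance, let $\varphi(N)=\frac{\sqrt{2\ln N}}{N+1}$, and let $P_{\mathsf{sync}}(\gamma,N)$ denote the probability that the Kuramoto system $\frac{d}{dt}\theta_i=\omega_i+\gamma\sum_{j=1}^N\sin(\theta_j-\theta_i)$, $i=1,\dots,N$, has a stable state with all oscillators locked (a fully synchronous solution). Let $\delta>0$ be fixed. Then: (i) if $\delta<1$, then $\lim_{N\to\infty}P_{\mathsf{sync}}(\delta\varphi(N),N)=0$; (ii) if $\delta\ge2$, then $\lim_{N\to\infty}P_{\mathsf{sync}}(\delta\varphi(N),N)=1$.
   Context: Let $f_i(\theta)=\sum_{j=1}^N\sin(\theta_j-\theta_i)$ for $\theta\in\mathbb{T}^N=(\mathbb{R}/2\pi\mathbb{Z})^N$. Given $\gamma>0$ and $\omega\in\mathbb{R}^N$, pass to the co-rotating frame, i.e. replace $\omega$ by $\tilde\omega_i=\omega_i-\frac1N\sum_k\omega_k$. The system has a fully synchronous solution (a stable state with all oscillators locked) if there is $\theta\in\mathbb{T}^N$ with $\gamma f(\theta)=-\tilde\omega$ such that the Jacobian matrix $J(\theta)=(\partial f_i/\partial\theta_j)_{i,j}$ is negative semi-definite with a one-dimensional kernel. *)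

theory Defs
  imports "HOL-Probability.Probability" "Jordan_Normal_Form.Matrix_Kernel"
begin

(* Oscillators are numbered 0, ..., N - 1. A point of the torus (R / 2 pi Z)^N is given by real
   representatives theta 0, ..., theta (N - 1); everything below is 2 pi-periodic in each of them,
   and the values theta i with i >= N are irrelevant. *)

definition coupling :: "nat \<Rightarrow> (nat \<Rightarrow> real) \<Rightarrow> nat \<Rightarrow> real" where
  "coupling N \<theta> i = (\<Sum>j<N. sin (\<theta> j - \<theta> i))"

definition jacobian :: "nat \<Rightarrow> (nat \<Rightarrow> real) \<Rightarrow> real mat" where
  "jacobian N \<theta> = mat N N (\<lambda>(i, j). deriv (\<lambda>t. coupling N (\<theta>(j := t)) i) (\<theta> j))"

definition co_rotating :: "nat \<Rightarrow> (nat \<Rightarrow> real) \<Rightarrow> nat \<Rightarrow> real" where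
  "co_rotating N \<omega> i = \<omega> i - (\<Sum>k<N. \<omega> k) / real N"

definition negative_semidefinite :: "real mat \<Rightarrow> bool" where
  "negative_semidefinite A \<longleftrightarrow> square_mat A \<and> transpose_mat A = A \<and>
     (\<forall>v\<in>carrier_vec (dim_col A). scalar_prod v (mult_mat_vec A v) \<le> 0)"

definition has_fully_synchronous_solution :: "nat \<Rightarrow> real \<Rightarrow> (nat \<Rightarrow> real) \<Rightarrow> bool" where
  "has_fully_synchronous_solution N \<gamma> \<omega> \<longleftrightarrow>
     (\<exists>\<theta>. (\<forall>i<N. \<gamma> * coupling N \<theta> i = - co_rotating N \<omega> i) \<and>
          negative_semidefinite (jacobian N \<theta>) \<and> kernel_dim (jacobian N \<theta>) = 1)"

definition P_sync :: "'a measure \<Rightarrow> (nat \<Rightarrow> 'a \<Rightarrow> real) \<Rightarrow> real \<Rightarrow> nat \<Rightarrow> real" where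
  "P_sync M \<omega> \<gamma> N =
     measure M {x \<in> space M. has_fully_synchronous_solution N \<gamma> (\<lambda>i. \<omega> i x)}"

definition \<phi> :: "nat \<Rightarrow> real" where
  "\<phi> N = sqrt (2 * ln (real N)) / (real N + 1)"

end

theory Submission
  imports Defs "HOL-Real_Asymp.Real_Asymp"
begin

text \<open>
  Since \<open>\<bar>f i\<bar> \<le> N\<close>, a fully synchronous solution forces every co-rotating frequency to be at
  most \<open>\<gamma> N < \<delta> L\<close> with \<open>L = sqrt (2 ln N)\<close>. The mean of the frequencies is \<open>o(L)\<close>, because their sum of
  squares has expectation \<open>N\<close>, while their maximum exceeds \<open>a L\<close> with high probability for every \<open>a < 1\<close>;
  this excludes \<open>\<delta> < 1\<close>.

  Conversely, write \<open>x i\<close> for the co-rotating frequencies. If \<open>R\<close> solves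
  \<open>R = (\<Sum>i. sqrt (1 - (x i / (\<gamma> R))\<^sup>2))\<close>, then \<open>\<theta> i = arcsin (x i / (\<gamma> R))\<close> is an equilibrium whose order parameter
  has modulus \<open>R / N\<close>. For \<open>\<delta> \<ge> 2\<close> the sum of squares is so small compared with \<open>(\<gamma> N)\<^sup>2 N\<close>
  that the intermediate value theorem gives such an \<open>R\<close> in \<open>[9 N / 10, N]\<close>, and the maximum is so small
  that all phase differences have positive cosine. Then the quadratic form
  \<open>- (\<Sum>i j. cos (\<theta> j - \<theta> i) (v j - v i)\<^sup>2) / 2\<close> of the Jacobian is negative off the constant vectors.

  As \<^const>\<open>measure\<close> is \<open>0\<close> on sets that are not measurable, the lower bound on the probability also needs
  the set of synchronizing frequencies to be Borel: it is the preimage of a countable union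
  of compact sets.
\<close>

no_notation Finite_Cartesian_Product.vec_nth (infixl "$" 90)
no_notation inner (infix "\<bullet>" 70)

section \<open>The Jacobian of the Kuramoto flow\<close>

lemma coupling_cong:
  assumes "\<And>i. i < N \<Longrightarrow> \<theta> i = \<theta>' i" "i < N"
  shows "coupling N \<theta> i = coupling N \<theta>' i"
  unfolding coupling_def using assms by (intro sum.cong) auto

text \<open>The angle \<open>\<theta> j\<close> enters summand \<open>j\<close> positively and, if
  \<open>i = j\<close>, every summand negatively. In that case summand \<open>j\<close> is
  constantly \<open>sin 0\<close>, and the leading \<open>cos 0\<close> cancels its share of the
  sum, so one formula covers both cases.\<close>

lemma coupling_has_derivative:
  assumes "j < N"
  shows "((\<lambda>t. coupling N (\<theta>(j := t)) i) has_real_derivative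
    cos (\<theta> j - \<theta> i) - (if i = j then \<Sum>k<N. cos (\<theta> k - \<theta> i) else 0)) (at (\<theta> j))"
proof -
  have d: "((\<lambda>t. (\<theta>(j := t)) k) has_real_derivative of_bool (k = j)) (at (\<theta> j))" for k
    by (cases "k = j") auto
  have d': "((\<lambda>t. sin ((\<theta>(j := t)) k - (\<theta>(j := t)) i)) has_real_derivative
      cos (\<theta> k - \<theta> i) * (of_bool (k = j) - of_bool (i = j))) (at (\<theta> j))" for k
    using DERIV_fun_sin[OF DERIV_diff[OF d[of k] d[of i]]] by simp
  have "((\<lambda>t. coupling N (\<theta>(j := t)) i) has_real_derivative
      (\<Sum>k<N. cos (\<theta> k - \<theta> i) * (of_bool (k = j) - of_bool (i = j)))) (at (\<theta> j))"
    unfolding coupling_def by (rule DERIV_sum) (rule d')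
  also have "(\<Sum>k<N. cos (\<theta> k - \<theta> i) * (of_bool (k = j) - of_bool (i = j))) =
      cos (\<theta> j - \<theta> i) - (if i = j then \<Sum>k<N. cos (\<theta> k - \<theta> i) else 0)"
    using assms by (simp add: right_diff_distrib sum_subtractf flip: sum_distrib_right)
  finally show ?thesis .
qed

lemma jacobian_eq:
  "jacobian N \<theta> = mat N N (\<lambda>(i, j). cos (\<theta> j - \<theta> i) - (if i = j then \<Sum>k<N. cos (\<theta> k - \<theta> i) else 0))"
  unfolding jacobian_def
  by (rule cong_mat) (auto intro!: DERIV_imp_deriv[OF coupling_has_derivative, simplified] split del: if_split)

lemma jacobian_carrier [simp]: "jacobian N \<theta> \<in> carrier_mat N N"
  by (simp add: jacobian_def)

lemma jacobian_dim [simp]: "dim_row (jacobian N \<theta>) = N" "dim_col (jacobian N \<theta>) = N"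
  by (simp_all add: jacobian_def)

lemma jacobian_cong:
  assumes "\<And>i. i < N \<Longrightarrow> \<theta> i = \<theta>' i"
  shows "jacobian N \<theta> = jacobian N \<theta>'"
  unfolding jacobian_eq using assms by (intro cong_mat) auto

lemma transpose_jacobian [simp]: "transpose_mat (jacobian N \<theta>) = jacobian N \<theta>"
proof (rule eq_matI)
  fix i j assume "i < dim_row (jacobian N \<theta>)" "j < dim_col (jacobian N \<theta>)"
  then show "transpose_mat (jacobian N \<theta>) $$ (i, j) = jacobian N \<theta> $$ (i, j)"
    using cos_minus[of "\<theta> j - \<theta> i"] by (auto simp: jacobian_eq)
qed auto

text \<open>The rows of the Jacobian sum to zero, so it sees only differences of coordinates: up to
  sign it is the Laplacian of the complete graph with weights
  \<open>cos (\<theta> j - \<theta> i)\<close>.\<close>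

lemma jacobian_mult_vec:
  assumes v: "v \<in> carrier_vec N" and i: "i < N"
  shows "(jacobian N \<theta> *\<^sub>v v) $ i = (\<Sum>j<N. cos (\<theta> j - \<theta> i) * (v $ j - v $ i))"
proof -
  have "(jacobian N \<theta> *\<^sub>v v) $ i =
      (\<Sum>j<N. (cos (\<theta> j - \<theta> i) - (if i = j then \<Sum>k<N. cos (\<theta> k - \<theta> i) else 0)) * v $ j)"
    using v i by (auto simp: jacobian_eq scalar_prod_def lessThan_atLeast0 intro!: sum.cong)
  also have "\<dots> = (\<Sum>j<N. cos (\<theta> j - \<theta> i) * v $ j - (if j = i then (\<Sum>k<N. cos (\<theta> k - \<theta> i)) * v $ i else 0))"
    by (intro sum.cong) (auto simp: algebra_simps)
  also have "\<dots> = (\<Sum>j<N. cos (\<theta> j - \<theta> i) * (v $ j - v $ i))"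
    using i by (simp add: sum_subtractf right_diff_distrib sum_distrib_right sum.delta)
  finally show ?thesis .
qed

text \<open>The weights are symmetric, so averaging the double sum with its version under exchange
  of \<open>i\<close> and \<open>j\<close> turns the products \<open>v $ i * (v $ j - v $ i)\<close>
  into minus half a square.\<close>

lemma jacobian_quadratic_form:
  assumes v: "v \<in> carrier_vec N"
  shows "v \<bullet> (jacobian N \<theta> *\<^sub>v v) = - (\<Sum>i<N. \<Sum>j<N. cos (\<theta> j - \<theta> i) * (v $ j - v $ i)\<^sup>2) / 2"
proof -
  define c where "c i j = cos (\<theta> j - \<theta> i)" for i j
  have c: "c i j = c j i" for i j
    using cos_minus[of "\<theta> j - \<theta> i"] by (simp add: c_def)
  have eq: "v \<bullet> (jacobian N \<theta> *\<^sub>v v) = (\<Sum>i<N. \<Sum>j<N. c i j * v $ i * (v $ j - v $ i))"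
  proof -
    have "v \<bullet> (jacobian N \<theta> *\<^sub>v v) = (\<Sum>i<N. v $ i * (jacobian N \<theta> *\<^sub>v v) $ i)"
      using v by (simp add: scalar_prod_def lessThan_atLeast0)
    also have "\<dots> = (\<Sum>i<N. \<Sum>j<N. c i j * v $ i * (v $ j - v $ i))"
      using v by (intro sum.cong refl) (auto simp del: index_mult_mat_vec
          simp: jacobian_mult_vec sum_distrib_left c_def mult_ac intro!: sum.cong)
    finally show ?thesis .
  qed
  have eq2: "(\<Sum>i<N. \<Sum>j<N. c i j * v $ i * (v $ j - v $ i)) = (\<Sum>i<N. \<Sum>j<N. c i j * v $ j * (v $ i - v $ j))"
    by (subst sum.swap) (simp add: c)
  have "2 * (v \<bullet> (jacobian N \<theta> *\<^sub>v v)) =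
     (\<Sum>i<N. \<Sum>j<N. c i j * v $ i * (v $ j - v $ i) + c i j * v $ j * (v $ i - v $ j))"
    using eq eq2 by (simp add: sum.distrib)
  also have "\<dots> = (\<Sum>i<N. \<Sum>j<N. - (c i j * (v $ j - v $ i)\<^sup>2))"
    by (intro sum.cong refl) (simp add: power2_eq_square algebra_simps)
  finally show ?thesis by (simp add: sum_negf c_def)
qed

text \<open>A nonzero kernel vector is linearly independent, so the kernel is one-dimensional
  exactly if this vector spans it. This trades \<open>kernel_dim\<close> for a condition on
  vectors.\<close>

lemma kernel_dim_eq_1_iff:
  fixes A :: "'a :: field mat"
  assumes A: "A \<in> carrier_mat m n" and u: "u \<in> carrier_vec n" "u \<noteq> 0\<^sub>v n" "A *\<^sub>v u = 0\<^sub>v m"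
  shows "kernel_dim A = 1 \<longleftrightarrow> (\<forall>v\<in>carrier_vec n. A *\<^sub>v v = 0\<^sub>v m \<longrightarrow> (\<exists>c. v = c \<cdot>\<^sub>v u))"
proof -
  interpret kernel m n A by unfold_locales (rule A)
  have uk: "u \<in> mat_kernel A" using A u by (intro mat_kernelI)
  have lincomb_u: "lincomb a {u} = a u \<cdot>\<^sub>v u" for a
  proof (rule eq_vecI)
    have "lincomb a {u} \<in> mat_kernel A"
      using uk by (intro Ker.lincomb_closed) auto
    then show "dim_vec (lincomb a {u}) = dim_vec (a u \<cdot>\<^sub>v u)"
      using A u(1) by (auto simp: mat_kernel)
  qed (use uk u(1) lincomb_index[of _ "{u}" a] in auto)
  have "span {u} = {lincomb a {u} | a. a \<in> {u} \<rightarrow> UNIV}"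
    using Ker.finite_span[of "{u}"] uk by auto
  also have "\<dots> = {c \<cdot>\<^sub>v u | c. True}"
    unfolding lincomb_u by (auto intro: exI[of _ "\<lambda>_. _"])
  finally have span: "span {u} = {c \<cdot>\<^sub>v u | c. True}" .
  have iff: "(\<forall>v\<in>carrier_vec n. A *\<^sub>v v = 0\<^sub>v m \<longrightarrow> (\<exists>c. v = c \<cdot>\<^sub>v u)) \<longleftrightarrow> span {u} = mat_kernel A"
    using mat_kernel[OF A] uk Ker.span_is_subset2[of "{u}"] unfolding span by auto
  obtain k where k: "k < n" "u $ k \<noteq> 0"
    using u(1,2) by (metis carrier_vecD eq_vecI index_zero_vec(1) zero_carrier_vec)
  have li: "lin_indpt {u}"
  proof (rule Ker.finite_lin_indpt2)
    fix a assume "lincomb a {u} = 0\<^sub>v n"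
    then have "(a u \<cdot>\<^sub>v u) $ k = 0"
      using k by (simp add: lincomb_u)
    then show "\<forall>v\<in>{u}. a v = 0"
      using k u(1) by simp
  qed (use uk in auto)
  show ?thesis
  proof
    assume "kernel_dim A = 1"
    then have "dim = 1" by simp
    \<comment> \<open>An independent set with \<open>dim\<close> elements is a basis only once the
      kernel is known to be finite-dimensional.\<close>
    obtain B where "finite B" "basis B" using kernel_basis_exists[OF A] by auto
    then have "Ker.fin_dim" by (auto simp: Ker.fin_dim_def Ker.basis_def)
    then have "basis {u}"
      using Ker.dim_li_is_basis[of "{u}"] li uk \<open>dim = 1\<close> by auto
    then show "\<forall>v\<in>carrier_vec n. A *\<^sub>v v = 0\<^sub>v m \<longrightarrow> (\<exists>c. v = c \<cdot>\<^sub>v u)"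
      unfolding iff by (simp add: Ker.basis_def)
  next
    assume "\<forall>v\<in>carrier_vec n. A *\<^sub>v v = 0\<^sub>v m \<longrightarrow> (\<exists>c. v = c \<cdot>\<^sub>v u)"
    then have "span {u} = mat_kernel A" unfolding iff .
    from Ker.dim1I[OF this] u uk show "kernel_dim A = 1" by simp
  qed
qed

lemma cos_diff_commute: "cos (x - y) = cos (y - x)" for x y :: real
  using cos_minus[of "x - y"] by simp

text \<open>The mean-field form: the other oscillators act only through the real and imaginary parts
  of the order parameter, the sum of the \<open>exp (i \<theta> j)\<close>.\<close>

lemma coupling_cos_sin:
  "coupling N \<theta> i = cos (\<theta> i) * (\<Sum>j<N. sin (\<theta> j)) - sin (\<theta> i) * (\<Sum>j<N. cos (\<theta> j))"
  by (simp add: coupling_def sin_diff sum_subtractf sum_distrib_left mult_ac)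

section \<open>Rotation invariance and the kernel of the Jacobian\<close>

lemma jacobian_mult_one: "jacobian N \<theta> *\<^sub>v vec N (\<lambda>_. 1) = 0\<^sub>v N"
  by (rule eq_vecI) (simp_all add: jacobian_mult_vec del: index_mult_mat_vec)

lemma kernel_dim_jacobian_iff:
  assumes "N \<ge> 1"
  shows "kernel_dim (jacobian N \<theta>) = 1 \<longleftrightarrow>
    (\<forall>v\<in>carrier_vec N. jacobian N \<theta> *\<^sub>v v = 0\<^sub>v N \<longrightarrow> (\<exists>c. v = c \<cdot>\<^sub>v vec N (\<lambda>_. 1)))"
proof (rule kernel_dim_eq_1_iff)
  have "vec N (\<lambda>_. 1 :: real) $ 0 \<noteq> 0\<^sub>v N $ 0"
    using assms by simp
  then show "vec N (\<lambda>_. 1 :: real) \<noteq> 0\<^sub>v N" by metis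
qed (simp_all add: jacobian_mult_one)

text \<open>The weighted differences are antisymmetric in \<open>i\<close> and \<open>j\<close>.
  Hence the image of the Jacobian is orthogonal to the constant vectors, which form the image of the
  all-ones matrix.\<close>

lemma sum_jacobian_mult_vec:
  assumes "v \<in> carrier_vec N"
  shows "(\<Sum>i<N. (jacobian N \<theta> *\<^sub>v v) $ i) = 0"
proof -
  let ?S = "\<Sum>i<N. \<Sum>j<N. cos (\<theta> j - \<theta> i) * (v $ j - v $ i)"
  have "?S = (\<Sum>i<N. \<Sum>j<N. cos (\<theta> i - \<theta> j) * (v $ i - v $ j))"
    by (rule sum.swap)
  also have "\<dots> = - ?S"
    unfolding sum_negf[symmetric]
    by (intro sum.cong refl) (simp add: cos_diff_commute[of "\<theta> _" "\<theta> _"] algebra_simps)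
  finally show ?thesis
    using assms by (simp add: jacobian_mult_vec del: index_mult_mat_vec)
qed

text \<open>Turns the kernel condition into a condition on a continuous function of \<open>\<theta>\<close>; subtracting the
  all-ones matrix removes exactly the constant vectors from the kernel.\<close>

lemma kernel_dim_jacobian_eq_1_iff_det:
  assumes N: "N \<ge> 1"
  shows "kernel_dim (jacobian N \<theta>) = 1 \<longleftrightarrow> det (jacobian N \<theta> - mat N N (\<lambda>_. 1)) \<noteq> 0"
proof -
  let ?J = "jacobian N \<theta>" and ?E = "mat N N (\<lambda>_. 1 :: real)" and ?u = "vec N (\<lambda>_. 1 :: real)"
  have sub: "(?J - ?E) *\<^sub>v v = ?J *\<^sub>v v - (\<Sum>j<N. v $ j) \<cdot>\<^sub>v ?u" if "v \<in> carrier_vec N" for v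
  proof -
    have "?E *\<^sub>v v = (\<Sum>j<N. v $ j) \<cdot>\<^sub>v ?u"
      using that by (intro eq_vecI) (auto simp: scalar_prod_def lessThan_atLeast0)
    then show ?thesis
      using that by (simp add: minus_mult_distrib_mat_vec[of _ N N])
  qed
  \<comment> \<open>Summing the coordinates removes the Jacobian part of the equation, so the two
    parts must vanish separately.\<close>
  have ker: "(?J - ?E) *\<^sub>v v = 0\<^sub>v N \<longleftrightarrow> ?J *\<^sub>v v = 0\<^sub>v N \<and> (\<Sum>j<N. v $ j) = 0"
    if v: "v \<in> carrier_vec N" for v
  proof
    assume "(?J - ?E) *\<^sub>v v = 0\<^sub>v N"
    then have "(?J *\<^sub>v v - (\<Sum>j<N. v $ j) \<cdot>\<^sub>v ?u) $ i = 0" if "i < N" for i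
      using sub[OF v] that by simp
    then have *: "(?J *\<^sub>v v) $ i = (\<Sum>j<N. v $ j)" if "i < N" for i
      using that by (auto simp del: index_mult_mat_vec)
    then have "real N * (\<Sum>j<N. v $ j) = 0"
      using sum_jacobian_mult_vec[OF v, of \<theta>] by (simp del: index_mult_mat_vec)
    then have s: "(\<Sum>j<N. v $ j) = 0" using N by simp
    have "?J *\<^sub>v v = 0\<^sub>v N"
      by (rule eq_vecI) (use * s in \<open>auto simp del: index_mult_mat_vec\<close>)
    then show "?J *\<^sub>v v = 0\<^sub>v N \<and> (\<Sum>j<N. v $ j) = 0" using s by simp
  next
    assume "?J *\<^sub>v v = 0\<^sub>v N \<and> (\<Sum>j<N. v $ j) = 0"
    then show "(?J - ?E) *\<^sub>v v = 0\<^sub>v N"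
      unfolding sub[OF v] by auto
  qed
  have "?J - ?E \<in> carrier_mat N N" by (intro minus_carrier_mat) simp
  note det = det_0_iff_vec_prod_zero_field[OF this]
  show ?thesis
  proof
    assume dim: "kernel_dim ?J = 1"
    show "det (?J - ?E) \<noteq> 0"
    proof
      assume "det (?J - ?E) = 0"
      then obtain v where v: "v \<in> carrier_vec N" "v \<noteq> 0\<^sub>v N" "?J *\<^sub>v v = 0\<^sub>v N" "(\<Sum>j<N. v $ j) = 0"
        using det ker by blast
      then obtain c where c: "v = c \<cdot>\<^sub>v ?u"
        using dim kernel_dim_jacobian_iff[OF N] by blast
      then have "(\<Sum>j<N. v $ j) = real N * c" by simp
      then have "c = 0" using v(4) N by simp
      then show False using c v(2) by auto
    qed
  next
    assume nz: "det (?J - ?E) \<noteq> 0"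
    show "kernel_dim ?J = 1"
      unfolding kernel_dim_jacobian_iff[OF N]
    proof (intro ballI impI)
      fix v assume v: "v \<in> carrier_vec N" and Jv: "?J *\<^sub>v v = 0\<^sub>v N"
      \<comment> \<open>Subtracting the mean moves \<open>v\<close> into the hyperplane of
        coordinate sum zero without changing its image under \<open>?J\<close>; there
        \<open>?J\<close> and \<open>?J - ?E\<close> agree, and the latter is injective.\<close>
      define m where "m = (\<Sum>j<N. v $ j) / real N"
      define w where "w = v - m \<cdot>\<^sub>v ?u"
      have w: "w \<in> carrier_vec N" using v by (simp add: w_def)
      have "?J *\<^sub>v w = 0\<^sub>v N"
        using v Jv mult_mat_vec[of ?J N N ?u m] unfolding w_def
        by (subst mult_minus_distrib_mat_vec[of _ N N]) (auto simp: jacobian_mult_one)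
      moreover have "(\<Sum>j<N. w $ j) = 0"
        using v N by (simp add: w_def m_def sum_subtractf)
      ultimately have "w = 0\<^sub>v N"
        using nz det ker[OF w] w by blast
      then have "v = m \<cdot>\<^sub>v ?u"
        using v unfolding w_def by (auto simp: vec_eq_iff)
      then show "\<exists>c. v = c \<cdot>\<^sub>v ?u" ..
    qed
  qed
qed

text \<open>With positive weights every term of the quadratic form has the same sign. A kernel
  vector makes the form vanish, which forces each difference of its coordinates to be zero.\<close>

lemma jacobian_stable:
  assumes N: "N \<ge> 1" and pos: "\<And>i j. i < N \<Longrightarrow> j < N \<Longrightarrow> cos (\<theta> j - \<theta> i) > 0"
  shows "negative_semidefinite (jacobian N \<theta>)" "kernel_dim (jacobian N \<theta>) = 1"
proof -
  have nonneg: "(\<Sum>i<N. \<Sum>j<N. cos (\<theta> j - \<theta> i) * (v $ j - v $ i)\<^sup>2) \<ge> 0" for v :: "real vec"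
    using pos by (intro sum_nonneg) (simp add: less_imp_le)
  show "negative_semidefinite (jacobian N \<theta>)"
    using nonneg by (auto simp: negative_semidefinite_def jacobian_quadratic_form)
  show "kernel_dim (jacobian N \<theta>) = 1"
    unfolding kernel_dim_jacobian_iff[OF N]
  proof (intro ballI impI)
    fix v assume v: "v \<in> carrier_vec N" and "jacobian N \<theta> *\<^sub>v v = 0\<^sub>v N"
    then have "v \<bullet> (jacobian N \<theta> *\<^sub>v v) = 0" by simp
    then have sum0: "(\<Sum>i<N. \<Sum>j<N. cos (\<theta> j - \<theta> i) * (v $ j - v $ i)\<^sup>2) = 0"
      using v by (simp add: jacobian_quadratic_form)
    have nn: "0 \<le> cos (\<theta> j - \<theta> i) * (v $ j - v $ i)\<^sup>2" if "i < N" "j < N" for i j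
      using pos[OF that] by simp
    have const: "v $ j = v $ i" if "i < N" "j < N" for i j
    proof -
      have "(\<Sum>j<N. cos (\<theta> j - \<theta> i) * (v $ j - v $ i)\<^sup>2) = 0"
      proof (rule sum_nonneg_0[OF _ _ sum0])
        show "0 \<le> (\<Sum>j<N. cos (\<theta> j - \<theta> k) * (v $ j - v $ k)\<^sup>2)" if "k \<in> {..<N}" for k
          using nn[of k] that by (intro sum_nonneg) simp
      qed (use that in simp_all)
      then have "cos (\<theta> j - \<theta> i) * (v $ j - v $ i)\<^sup>2 = 0"
        by (rule sum_nonneg_0[rotated 2]) (use nn[OF that(1)] that(2) in simp_all)
      then show ?thesis
        using pos[OF that] by simp
    qed
    have "v = v $ 0 \<cdot>\<^sub>v vec N (\<lambda>_. 1)"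
    proof (rule eq_vecI)
      fix j assume "j < dim_vec (v $ 0 \<cdot>\<^sub>v vec N (\<lambda>_. 1))"
      then show "v $ j = (v $ 0 \<cdot>\<^sub>v vec N (\<lambda>_. 1)) $ j"
        using const[of 0 j] N by simp
    qed (use v in simp)
    then show "\<exists>c. v = c \<cdot>\<^sub>v vec N (\<lambda>_. 1)" ..
  qed
qed

section \<open>Conditions for synchrony\<close>

text \<open>The variance decomposition. It serves twice: the left side is nonnegative, which bounds
  the mean, and dropping the mean term bounds the co-rotating squares by the original ones.\<close>

lemma sum_co_rotating_squares:
  assumes "N \<ge> 1"
  shows "(\<Sum>i<N. (co_rotating N \<omega> i)\<^sup>2) = (\<Sum>i<N. (\<omega> i)\<^sup>2) - N * ((\<Sum>i<N. \<omega> i) / N)\<^sup>2"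
proof -
  define m where "m = (\<Sum>i<N. \<omega> i) / N"
  have s: "(\<Sum>i<N. \<omega> i) = N * m" using assms by (simp add: m_def)
  have "(\<Sum>i<N. (co_rotating N \<omega> i)\<^sup>2) = (\<Sum>i<N. (\<omega> i)\<^sup>2 - 2 * m * \<omega> i + m\<^sup>2)"
    unfolding co_rotating_def m_def[symmetric] by (intro sum.cong refl) (simp add: power2_diff)
  also have "\<dots> = (\<Sum>i<N. (\<omega> i)\<^sup>2) - 2 * m * (\<Sum>i<N. \<omega> i) + N * m\<^sup>2"
    unfolding sum.distrib sum_subtractf sum_distrib_left[symmetric] by simp
  also have "\<dots> = (\<Sum>i<N. (\<omega> i)\<^sup>2) - N * m\<^sup>2"
    unfolding s by (simp add: power2_eq_square)
  finally show ?thesis unfolding m_def .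
qed

text \<open>Cauchy-Schwarz for the mean, in the guise of a nonnegative variance. A single event
  about the sum of squares thus controls the mean.\<close>

lemma mean_less:
  assumes N: "N \<ge> 1" and b: "b \<ge> 0" and sq: "(\<Sum>i<N. (\<omega> i)\<^sup>2) < b\<^sup>2 * N"
  shows "\<bar>(\<Sum>i<N. \<omega> i) / real N\<bar> < b"
proof -
  have "0 \<le> (\<Sum>i<N. (co_rotating N \<omega> i)\<^sup>2)"
    by (intro sum_nonneg) simp
  then have "N * ((\<Sum>i<N. \<omega> i) / N)\<^sup>2 < N * b\<^sup>2"
    using sq unfolding sum_co_rotating_squares[OF N] by (simp add: mult.commute)
  then have "((\<Sum>i<N. \<omega> i) / N)\<^sup>2 < b\<^sup>2"
    by (rule mult_left_less_imp_less) simp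
  then show ?thesis
    using b unfolding power2_abs[symmetric, of "(\<Sum>i<N. \<omega> i) / N"] by (rule power2_less_imp_less)
qed

lemma sum_co_rotating: "N \<ge> 1 \<Longrightarrow> (\<Sum>i<N. co_rotating N \<omega> i) = 0"
  by (simp add: co_rotating_def sum_subtractf)

text \<open>The constants fit the search for \<open>R\<close> between \<open>9 / 10 * N\<close> and
  \<open>N\<close>. Dividing 3/5 by 9/10 bounds the sines by 2/3, whose square 4/9 is below 1/2, so
  phases stay within pi/4 of zero. Dividing 2/25 by 81/100 bounds the mean squared sine by 8/81,
  which is less than 1/10.\<close>

lemma has_fully_synchronous_solutionI:
  assumes N: "N \<ge> 1" and \<gamma>: "\<gamma> > 0"
    and max: "\<And>i. i < N \<Longrightarrow> \<bar>co_rotating N \<omega> i\<bar> \<le> 3 / 5 * (\<gamma> * N)"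
    and sq: "(\<Sum>i<N. (co_rotating N \<omega> i)\<^sup>2) \<le> 2 / 25 * (\<gamma> * N)\<^sup>2 * N"
  shows "has_fully_synchronous_solution N \<gamma> \<omega>"
proof -
  \<comment> \<open>The sine that oscillator \<open>i\<close> must have in equilibrium if all sines
    sum to 0 and all cosines sum to \<open>R\<close>.\<close>
  define s where "s R i = co_rotating N \<omega> i / (\<gamma> * R)" for R i
  have s_le: "\<bar>s R i\<bar> \<le> 2 / 3" if "i < N" "9 / 10 * N \<le> R" for R i
  proof -
    have "\<bar>co_rotating N \<omega> i\<bar> \<le> 2 / 3 * (\<gamma> * (9 / 10 * N))"
      using max[OF that(1)] by simp
    also have "\<dots> \<le> 2 / 3 * (\<gamma> * R)"
      using that(2) \<gamma> by (intro mult_left_mono) auto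
    finally show ?thesis
      using \<gamma> that N by (simp add: s_def abs_mult pos_divide_le_eq)
  qed
  have s_sq: "(s R i)\<^sup>2 \<le> 4 / 9" if "i < N" "9 / 10 * N \<le> R" for R i
    using power_mono[OF s_le[OF that], of 2] by (simp add: power2_eq_square)
  \<comment> \<open>The sum of the nonnegative cosines belonging to these sines; a fixed point of
    \<open>g\<close> makes the guess \<open>R\<close> self-consistent.\<close>
  define g where "g R = (\<Sum>i<N. sqrt (1 - (s R i)\<^sup>2))" for R
  have "\<exists>R\<ge>9 / 10 * real N. R \<le> N \<and> g R - R = 0"
  proof (rule IVT2')
    have "continuous_on {9 / 10 * real N..N} g"
      unfolding g_def s_def using N \<gamma> by (intro continuous_intros) auto
    then show "continuous_on {9 / 10 * real N..N} (\<lambda>R. g R - R)"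
      by (intro continuous_intros)
    have "g N \<le> (\<Sum>i<N. 1)"
      unfolding g_def by (intro sum_mono) simp
    then show "g N - N \<le> 0" by simp
    let ?R = "9 / 10 * real N"
    have "(\<Sum>i<N. (s ?R i)\<^sup>2) = (\<Sum>i<N. (co_rotating N \<omega> i)\<^sup>2) / (\<gamma> * ?R)\<^sup>2"
      unfolding s_def power_divide sum_divide_distrib ..
    also have "\<dots> \<le> (2 / 25 * (\<gamma> * N)\<^sup>2 * N) / (\<gamma> * ?R)\<^sup>2"
      by (intro divide_right_mono sq) simp
    also have "\<dots> = 8 / 81 * N"
      using N \<gamma> by (simp add: power2_eq_square field_simps)
    finally have "N - 8 / 81 * N \<le> (\<Sum>i<N. 1 - (s ?R i)\<^sup>2)"
      by (simp add: sum_subtractf)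
    \<comment> \<open>A number in the unit interval is at most its square root.\<close>
    also have "\<dots> \<le> g ?R"
      unfolding g_def
    proof (rule sum_mono)
      fix i assume i: "i \<in> {..<N}"
      have "1 - (s ?R i)\<^sup>2 \<ge> 0" using s_sq[of i ?R] i by simp
      then show "1 - (s ?R i)\<^sup>2 \<le> sqrt (1 - (s ?R i)\<^sup>2)"
        by (intro real_le_rsqrt) (simp add: power2_eq_square mult_left_le)
    qed
    finally show "0 \<le> g ?R - ?R" by simp
  qed simp
  then obtain R where R: "9 / 10 * real N \<le> R" "g R = R" by auto
  have "R > 0" using R N by (auto intro: less_le_trans[rotated])
  define \<theta> where "\<theta> i = arcsin (s R i)" for i
  have sin: "sin (\<theta> i) = s R i" and cos: "cos (\<theta> i) = sqrt (1 - (s R i)\<^sup>2)" if "i < N" for i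
    using s_le[OF that R(1)] by (auto simp: \<theta>_def cos_arcsin)
  \<comment> \<open>Passing to the co-rotating frame makes the sines cancel, so the order parameter
    is real.\<close>
  have "(\<Sum>i<N. sin (\<theta> i)) = (\<Sum>i<N. co_rotating N \<omega> i) / (\<gamma> * R)"
    by (simp add: sin s_def sum_divide_distrib)
  then have sum_sin: "(\<Sum>i<N. sin (\<theta> i)) = 0"
    using N by (simp add: sum_co_rotating)
  have sum_cos: "(\<Sum>i<N. cos (\<theta> i)) = R"
    using R(2) by (simp add: cos g_def)
  have cos_ge: "sqrt (5 / 9) \<le> cos (\<theta> i)" if "i < N" for i
    using s_sq[OF that R(1)] unfolding cos[OF that] by (intro real_sqrt_le_mono) simp
  \<comment> \<open>By the addition theorem the cosine is at least 5/9 - 4/9.\<close>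
  have "cos (\<theta> j - \<theta> i) > 0" if "i < N" "j < N" for i j
  proof -
    have "sqrt (5 / 9) * sqrt (5 / 9) \<le> cos (\<theta> j) * cos (\<theta> i)"
      using that by (intro mult_mono cos_ge order_trans[OF _ cos_ge]) auto
    moreover have "\<bar>sin (\<theta> j)\<bar> * \<bar>sin (\<theta> i)\<bar> \<le> 2 / 3 * (2 / 3)"
      using that s_le[OF _ R(1)] by (intro mult_mono) (auto simp: sin)
    then have "sin (\<theta> j) * sin (\<theta> i) \<ge> - 4 / 9"
      unfolding abs_mult[symmetric] by linarith
    ultimately show ?thesis
      by (simp add: cos_diff)
  qed
  note stable = jacobian_stable[of N \<theta>, OF N this]
  have "\<gamma> * coupling N \<theta> i = - co_rotating N \<omega> i" if "i < N" for i
  proof -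
    have "coupling N \<theta> i = - (s R i * R)"
      unfolding coupling_cos_sin sum_sin sum_cos sin[OF that] by simp
    then show ?thesis
      using \<gamma> \<open>R > 0\<close> by (simp add: s_def)
  qed
  with stable show ?thesis
    unfolding has_fully_synchronous_solution_def by (intro exI[of _ \<theta>]) simp
qed

text \<open>Each of the \<open>N\<close> sines is at least -1. One sign suffices, since synchrony
  will be excluded by a large positive frequency.\<close>

lemma has_fully_synchronous_solutionD:
  assumes "has_fully_synchronous_solution N \<gamma> \<omega>" "\<gamma> \<ge> 0" "i < N"
  shows "co_rotating N \<omega> i \<le> \<gamma> * N"
proof -
  obtain \<theta> where "\<gamma> * coupling N \<theta> i = - co_rotating N \<omega> i"
    using assms by (auto simp: has_fully_synchronous_solution_def)
  moreover have "- coupling N \<theta> i \<le> (\<Sum>j<N. 1)"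
    unfolding coupling_def sum_negf[symmetric] by (intro sum_mono) (use sin_ge_minus_one in \<open>auto simp: minus_le_iff\<close>)
  then have "\<gamma> * - coupling N \<theta> i \<le> \<gamma> * N"
    using assms by (intro mult_left_mono) auto
  ultimately show ?thesis by simp
qed

section \<open>Measurability of the synchronous set\<close>

lemma continuous_on_jacobian:
  assumes "i < N" "j < N"
  shows "continuous_on UNIV (\<lambda>\<theta>. jacobian N \<theta> $$ (i, j))"
  using assms by (cases "i = j") (auto simp: jacobian_eq intro!: continuous_intros)

text \<open>The Leibniz formula makes the determinant a polynomial in the entries; continuity is
  meant in the product topology on \<open>nat \<Rightarrow> real\<close>.\<close>

lemma continuous_on_det_jacobian:
  "continuous_on UNIV (\<lambda>\<theta>. det (jacobian N \<theta> - mat N N (\<lambda>_. 1)))"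
proof -
  have perm: "p i < N" if "p permutes {0..<N}" "i < N" for p i
    using permutes_in_image[OF that(1), of i] that(2) by simp
  have eq: "det (jacobian N \<theta> - mat N N (\<lambda>_. 1)) =
      (\<Sum>p | p permutes {0..<N}. signof p * (\<Prod>i = 0..<N. jacobian N \<theta> $$ (i, p i) - 1))" for \<theta>
    by (subst det_def'[of _ N]) (auto intro!: sum.cong prod.cong minus_carrier_mat simp: perm)
  show ?thesis
    unfolding eq by (intro continuous_intros continuous_on_jacobian) (auto simp: perm)
qed

text \<open>Tychonoff's theorem for the product topology on a function type.\<close>

lemma compact_PiE_UNIV:
  fixes S :: "'i \<Rightarrow> 'a::topological_space set"
  assumes "\<And>i. compact (S i)"
  shows "compact (PiE UNIV S)"
  using assms compactin_PiE[of "\<lambda>_. euclidean" UNIV S]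
  by (auto simp: euclidean_product_topology)

text \<open>The quantifier over \<theta> is a projection, which need not preserve Borel sets in
  general. Compactness helps: continuous images of compact sets are compact, hence closed.\<close>

lemma has_fully_synchronous_solution_borel:
  assumes N: "N \<ge> 1"
  shows "{\<omega>. has_fully_synchronous_solution N \<gamma> \<omega>} \<in> sets borel"
proof -
  \<comment> \<open>\<open>F\<close> and \<open>G\<close> are the two sides of the equilibrium
    equation, padded with zeros so that equality of functions means equality for all
    \<open>i < N\<close>.\<close>
  define F where "F \<theta> = (\<lambda>i. if i < N then \<gamma> * coupling N \<theta> i else 0)" for \<theta>
  define G where "G \<omega> = (\<lambda>i. if i < N then - co_rotating N \<omega> i else 0)" for \<omega>
  define E where "E = mat N N (\<lambda>_. 1 :: real)"
  \<comment> \<open>The stable phase configurations form a countable union of compact sets, up to the irrelevant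
    coordinates beyond \<open>N\<close>, which are set to \<open>0\<close>.\<close>
  define C where "C n = PiE UNIV (\<lambda>i. if i < N then {- real n..real n} else {0})
      \<inter> (\<Inter>v\<in>carrier_vec N. {\<theta>. v \<bullet> (jacobian N \<theta> *\<^sub>v v) \<le> 0})
      \<inter> {\<theta>. 1 / Suc n \<le> \<bar>det (jacobian N \<theta> - E)\<bar>}" for n
  have C_iff: "\<theta> \<in> C n \<longleftrightarrow> (\<forall>i<N. \<bar>\<theta> i\<bar> \<le> n) \<and> (\<forall>i\<ge>N. \<theta> i = 0) \<and>
      negative_semidefinite (jacobian N \<theta>) \<and> 1 / Suc n \<le> \<bar>det (jacobian N \<theta> - E)\<bar>" for n \<theta>
    by (auto simp: C_def negative_semidefinite_def PiE_iff abs_le_iff minus_le_iff not_less split: if_splits)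
  \<comment> \<open>Semidefiniteness is a closed condition, whereas a nonzero determinant is an open
    one; the margin \<open>1 / Suc n\<close> makes it closed.\<close>
  have "compact (C n)" for n
    unfolding C_def Int_assoc
  proof (intro compact_Int_closed closed_Int closed_INT ballI)
    show "compact (PiE UNIV (\<lambda>i. if i < N then {- real n..real n} else {0}))"
      by (rule compact_PiE_UNIV) auto
    show "closed {\<theta>. v \<bullet> (jacobian N \<theta> *\<^sub>v v) \<le> 0}" if "v \<in> carrier_vec N" for v
      using that unfolding jacobian_quadratic_form[OF that]
      by (intro closed_Collect_le continuous_intros) auto
    show "closed {\<theta>. 1 / Suc n \<le> \<bar>det (jacobian N \<theta> - E)\<bar>}"
      unfolding E_def by (intro closed_Collect_le continuous_intros continuous_on_det_jacobian)
  qed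
  moreover have "continuous_on UNIV F"
    unfolding F_def coupling_def
  proof (rule continuous_on_coordinatewise_then_product)
    show "continuous_on UNIV (\<lambda>\<theta>. if i < N then \<gamma> * (\<Sum>j<N. sin (\<theta> j - \<theta> i)) else 0)" for i
      by (cases "i < N") (auto intro!: continuous_intros)
  qed
  ultimately have "compact (F ` C n)" for n
    by (blast intro: compact_continuous_image continuous_on_subset)
  then have "F ` C n \<in> sets borel" for n
    by (intro borel_closed compact_imp_closed)
  then have "(\<Union>n. F ` C n) \<in> sets borel" by blast
  moreover have "continuous_on UNIV G"
    unfolding G_def co_rotating_def
  proof (rule continuous_on_coordinatewise_then_product)
    show "continuous_on UNIV (\<lambda>\<omega>. if i < N then - (\<omega> i - (\<Sum>k<N. \<omega> k) / real N) else 0)" for i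
      using N by (cases "i < N") (auto intro!: continuous_intros)
  qed
  then have "G \<in> borel_measurable borel"
    by (rule borel_measurable_continuous_onI)
  ultimately have "G -` (\<Union>n. F ` C n) \<inter> space borel \<in> sets borel"
    by (intro measurable_sets)
  moreover have "{\<omega>. has_fully_synchronous_solution N \<gamma> \<omega>} = G -` (\<Union>n. F ` C n)"
  proof (intro equalityI subsetI; simp)
    fix \<omega> assume "has_fully_synchronous_solution N \<gamma> \<omega>"
    then obtain \<theta> where eq: "\<And>i. i < N \<Longrightarrow> \<gamma> * coupling N \<theta> i = - co_rotating N \<omega> i"
      and stable: "negative_semidefinite (jacobian N \<theta>)" "kernel_dim (jacobian N \<theta>) = 1"
      by (auto simp: has_fully_synchronous_solution_def)
    define \<theta>' where "\<theta>' i = (if i < N then \<theta> i else 0)" for i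
    have J: "jacobian N \<theta>' = jacobian N \<theta>"
      by (rule jacobian_cong) (simp add: \<theta>'_def)
    have c: "coupling N \<theta>' i = coupling N \<theta> i" if "i < N" for i
      using that by (intro coupling_cong) (auto simp: \<theta>'_def)
    let ?d = "\<bar>det (jacobian N \<theta> - E)\<bar>"
    have "?d > 0"
      using stable(2) kernel_dim_jacobian_eq_1_iff_det[OF N] by (simp add: E_def)
    then obtain n1 where n1: "1 / Suc n1 < ?d"
      using nat_approx_posE by blast
    obtain n2 :: nat where n2: "(\<Sum>i<N. \<bar>\<theta> i\<bar>) \<le> n2"
      using real_arch_simple by blast
    have "\<bar>\<theta> i\<bar> \<le> max n1 n2" if "i < N" for i
      using n2 member_le_sum[of i "{..<N}" "\<lambda>i. \<bar>\<theta> i\<bar>"] that by auto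
    moreover have "1 / Suc (max n1 n2) \<le> 1 / Suc n1"
      by (intro divide_left_mono) auto
    ultimately have "\<theta>' \<in> C (max n1 n2)"
      using stable(1) n1 unfolding C_iff J by (auto simp: \<theta>'_def)
    moreover have "G \<omega> = F \<theta>'"
      by (auto simp: G_def F_def c eq)
    ultimately show "\<exists>n. G \<omega> \<in> F ` C n" by blast
  next
    fix \<omega> assume "\<exists>n. G \<omega> \<in> F ` C n"
    then obtain n \<theta> where \<theta>: "\<theta> \<in> C n" "G \<omega> = F \<theta>" by auto
    have "\<gamma> * coupling N \<theta> i = - co_rotating N \<omega> i" if "i < N" for i
      using fun_cong[OF \<theta>(2), of i] that by (simp add: F_def G_def)
    moreover have "0 < 1 / real (Suc n)" by simp
    then have "det (jacobian N \<theta> - E) \<noteq> 0"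
      using \<theta>(1) unfolding C_iff by auto
    ultimately show "has_fully_synchronous_solution N \<gamma> \<omega>"
      using \<theta>(1) kernel_dim_jacobian_eq_1_iff_det[OF N, of \<theta>]
      by (auto simp: has_fully_synchronous_solution_def C_iff E_def)
  qed
  ultimately show ?thesis by simp
qed

section \<open>Transfer to random frequencies\<close>

lemma has_fully_synchronous_solution_cong:
  assumes "\<And>i. i < N \<Longrightarrow> \<omega> i = \<omega>' i"
  shows "has_fully_synchronous_solution N \<gamma> \<omega> = has_fully_synchronous_solution N \<gamma> \<omega>'"
proof -
  have "co_rotating N \<omega> i = co_rotating N \<omega>' i" if "i < N" for i
    using assms that by (simp add: co_rotating_def)
  then show ?thesis by (simp add: has_fully_synchronous_solution_def)
qed

lemma sets_has_fully_synchronous_solution: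
  assumes N: "N \<ge> 1" and X: "\<And>i. i < N \<Longrightarrow> X i \<in> borel_measurable M"
  shows "{x \<in> space M. has_fully_synchronous_solution N \<gamma> (\<lambda>i. X i x)} \<in> sets M"
proof -
  let ?X = "\<lambda>x i. if i < N then X i x else 0"
  have "?X \<in> borel_measurable M"
  proof (rule measurable_coordinatewise_then_product)
    show "(\<lambda>x. ?X x i) \<in> borel_measurable M" for i
      using X by (cases "i < N") auto
  qed
  from measurable_sets[OF this has_fully_synchronous_solution_borel[OF N]]
  have "?X -` {\<omega>. has_fully_synchronous_solution N \<gamma> \<omega>} \<inter> space M \<in> sets M" .
  also have "?X -` {\<omega>. has_fully_synchronous_solution N \<gamma> \<omega>} \<inter> space M =
      {x \<in> space M. has_fully_synchronous_solution N \<gamma> (\<lambda>i. X i x)}"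
    using has_fully_synchronous_solution_cong[of N "\<lambda>i. X i _" "?X _" \<gamma>] by auto
  finally show ?thesis .
qed

section \<open>Gaussian estimates\<close>

lemma (in prob_space) std_normal_tail_le:
  assumes X: "distributed M lborel X std_normal_density" and t: "t \<ge> 0"
  shows "prob {x \<in> space M. t \<le> \<bar>X x\<bar>} \<le> 2 * exp (- t\<^sup>2 / 2)"
proof -
  \<comment> \<open>The density is compared with the Gaussian density shifted to the threshold.\<close>
  have one_sided: "std_normal_density x \<le> exp (- t\<^sup>2 / 2) * normal_density s 1 x"
    if "s\<^sup>2 = t\<^sup>2" "s * x \<ge> s\<^sup>2" for s x :: real
  proof -
    have "- (x\<^sup>2) / 2 \<le> - t\<^sup>2 / 2 + - ((x - s)\<^sup>2) / 2"
      using that by (simp add: power2_eq_square algebra_simps)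
    then have "exp (- (x\<^sup>2) / 2) \<le> exp (- t\<^sup>2 / 2) * exp (- ((x - s)\<^sup>2) / 2)"
      by (simp flip: exp_add)
    then show ?thesis
      by (simp add: normal_density_def divide_right_mono)
  qed
  \<comment> \<open>The shifts \<open>t\<close> and \<open>- t\<close> handle the two tails. Both
    shifted densities have mass one, whence the factor 2 after integration.\<close>
  have density: "std_normal_density x * indicator {x. t \<le> \<bar>x\<bar>} x
      \<le> exp (- t\<^sup>2 / 2) * (normal_density t 1 x + normal_density (- t) 1 x)" for x
  proof (cases "t \<le> \<bar>x\<bar>")
    case True
    then consider "x \<ge> t" | "- x \<ge> t" by linarith
    then show ?thesis
    proof cases
      case 1
      then have "std_normal_density x \<le> exp (- t\<^sup>2 / 2) * normal_density t 1 x"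
        using t by (intro one_sided) (auto simp: power2_eq_square intro: mult_left_mono)
      then show ?thesis using True by (simp add: distrib_left add_increasing2)
    next
      case 2
      then have "std_normal_density x \<le> exp (- t\<^sup>2 / 2) * normal_density (- t) 1 x"
        using t mult_left_mono[of t "- x" t] by (intro one_sided) (auto simp: power2_eq_square)
      then show ?thesis using True by (simp add: distrib_left add_increasing)
    qed
  qed (simp add: add_nonneg_nonneg)
  have "emeasure M {x \<in> space M. t \<le> \<bar>X x\<bar>} = emeasure M (X -` {x. t \<le> \<bar>x\<bar>} \<inter> space M)"
    by (rule arg_cong[of _ _ "emeasure M"]) auto
  also have "\<dots> = (\<integral>\<^sup>+x. ennreal (std_normal_density x) * indicator {x. t \<le> \<bar>x\<bar>} x \<partial>lborel)"
    by (rule distributed_emeasure[OF X]) simp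
  also have "\<dots> \<le> (\<integral>\<^sup>+x. ennreal (exp (- t\<^sup>2 / 2) * (normal_density t 1 x + normal_density (- t) 1 x)) \<partial>lborel)"
  proof (intro nn_integral_mono)
    fix x
    have "ennreal (std_normal_density x) * indicator {x. t \<le> \<bar>x\<bar>} x
        = ennreal (std_normal_density x * indicator {x. t \<le> \<bar>x\<bar>} x)"
      by (simp split: split_indicator)
    then show "ennreal (std_normal_density x) * indicator {x. t \<le> \<bar>x\<bar>} x
        \<le> ennreal (exp (- t\<^sup>2 / 2) * (normal_density t 1 x + normal_density (- t) 1 x))"
      using density[of x] by (simp add: ennreal_leI)
  qed
  also have "\<dots> = ennreal (2 * exp (- t\<^sup>2 / 2))"
    by (subst nn_integral_eq_integral)
      (auto simp: integral_normal_density add_nonneg_nonneg)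
  finally show ?thesis
    by (simp add: emeasure_eq_measure)
qed

text \<open>The density decreases on the interval from \<open>t\<close> to \<open>t + 1\<close>, so
  its value at the right end bounds the mass there. The loss is only
  \<open>exp (- t - 1 / 2)\<close>, of lower order than the Gaussian factor.\<close>

lemma (in prob_space) std_normal_tail_ge:
  assumes X: "distributed M lborel X std_normal_density" and t: "t \<ge> 0"
  shows "exp (- (t + 1)\<^sup>2 / 2) / sqrt (2 * pi) \<le> prob {x \<in> space M. t < X x}"
proof -
  let ?c = "exp (- (t + 1)\<^sup>2 / 2) / sqrt (2 * pi)"
  have "ennreal ?c = (\<integral>\<^sup>+x. ennreal ?c * indicator {t<..t + 1} x \<partial>lborel)"
    by (subst nn_integral_cmult_indicator) auto
  also have "\<dots> \<le> (\<integral>\<^sup>+x. ennreal (std_normal_density x) * indicator {t<..} x \<partial>lborel)"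
  proof (intro nn_integral_mono)
    fix x
    have "?c \<le> std_normal_density x" if "t < x" "x \<le> t + 1"
      using that t by (auto simp: normal_density_def intro!: divide_right_mono power_mono)
    then show "ennreal ?c * indicator {t<..t + 1} x \<le> ennreal (std_normal_density x) * indicator {t<..} x"
      by (auto split: split_indicator intro: ennreal_leI)
  qed
  also have "\<dots> = emeasure M (X -` {t<..} \<inter> space M)"
    by (rule distributed_emeasure[OF X, symmetric]) simp
  also have "\<dots> = emeasure M {x \<in> space M. t < X x}"
    by (rule arg_cong[of _ _ "emeasure M"]) auto
  finally show ?thesis
    by (simp add: emeasure_eq_measure)
qed

text \<open>Markov's inequality, each square having expectation one. It is strong enough because the
  thresholds used later are of order \<open>N * ln N\<close>.\<close>

lemma (in prob_space) sum_squares_std_normal_tail_le: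
  assumes X: "\<And>i. i \<in> I \<Longrightarrow> distributed M lborel (X i) std_normal_density" and c: "c > 0"
  shows "prob {x \<in> space M. c \<le> (\<Sum>i\<in>I. (X i x)\<^sup>2)} \<le> real (card I) / c"
proof -
  have int: "integrable M (\<lambda>x. (X i x)\<^sup>2)" if "i \<in> I" for i
    using distributed_integrable[OF X[OF that], of "\<lambda>x. x\<^sup>2"] integrable_std_normal_moment[of 2] by simp
  have ex: "expectation (\<lambda>x. (X i x)\<^sup>2) = 1" if "i \<in> I" for i
    using distributed_integral[OF X[OF that], of "\<lambda>x. x\<^sup>2"] integral_std_normal_moment_even[of 1] by simp
  have "prob {x \<in> space M. c \<le> (\<Sum>i\<in>I. (X i x)\<^sup>2)} \<le> expectation (\<lambda>x. \<Sum>i\<in>I. (X i x)\<^sup>2) / c"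
    using int c by (intro integral_Markov_inequality_measure[where A = "{}"]) (auto simp: sum_nonneg)
  also have "expectation (\<lambda>x. \<Sum>i\<in>I. (X i x)\<^sup>2) = real (card I)"
    using int by (simp add: Bochner_Integration.integral_sum ex)
  finally show ?thesis .
qed

text \<open>Independence turns the probability into a product, and each factor is at most
  \<open>1 - ?q \<le> exp (- ?q)\<close>.\<close>

lemma (in prob_space) indep_std_normal_all_le:
  fixes N :: nat
  assumes indep: "indep_vars (\<lambda>i. borel) X {..<N}"
    and X: "\<And>i. i < N \<Longrightarrow> distributed M lborel (X i) std_normal_density"
    and N: "N \<ge> 1" and t: "t \<ge> 0"
  shows "prob {x \<in> space M. \<forall>i<N. X i x \<le> t} \<le> exp (- (N * (exp (- (t + 1)\<^sup>2 / 2) / sqrt (2 * pi))))"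
proof -
  let ?q = "exp (- (t + 1)\<^sup>2 / 2) / sqrt (2 * pi)"
  have le: "prob (X i -` {..t} \<inter> space M) \<le> exp (- ?q)" if "i < N" for i
  proof -
    have [measurable]: "X i \<in> borel_measurable M"
      using distributed_measurable[OF X[OF that]] by simp
    have "X i -` {..t} \<inter> space M = space M - {x \<in> space M. t < X i x}" by auto
    then have "prob (X i -` {..t} \<inter> space M) = 1 - prob {x \<in> space M. t < X i x}"
      by (simp add: prob_compl)
    also have "\<dots> \<le> 1 + - ?q"
      using std_normal_tail_ge[OF X[OF that] t] by simp
    also have "\<dots> \<le> exp (- ?q)"
      by (rule exp_ge_add_one_self)
    finally show ?thesis .
  qed
  have ne: "{..<N} \<noteq> {}" using N by (simp add: lessThan_empty_iff)
  then have "{x \<in> space M. \<forall>i<N. X i x \<le> t} = (\<Inter>i\<in>{..<N}. X i -` {..t} \<inter> space M)"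
    by auto
  then have "prob {x \<in> space M. \<forall>i<N. X i x \<le> t} = (\<Prod>i<N. prob (X i -` {..t} \<inter> space M))"
    using indep_varsD_finite[OF indep ne finite_lessThan, of "\<lambda>_. {..t}"] by simp
  also have "\<dots> \<le> (\<Prod>i<N. exp (- ?q))"
    using le by (intro prod_mono) auto
  also have "\<dots> = exp (- (N * ?q))"
    by (simp flip: exp_of_nat_mult)
  finally show ?thesis .
qed

text \<open>Collected into one exponential, the inner exponent is
  \<open>(1 - a\<^sup>2) * ln N\<close> minus a term of order \<open>sqrt (ln N)\<close>, so it
  tends to infinity for \<open>a < 1\<close>.\<close>

lemma gaussian_maximum_lower_tendsto:
  fixes a :: real
  assumes "0 < a" "a < 1"
  shows "(\<lambda>N. exp (- (real N * (exp (- (a * sqrt (2 * ln (real N)) + 1)\<^sup>2 / 2) / sqrt (2 * pi))))) \<longlonglongrightarrow> 0"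
proof -
  have a2: "1 - a\<^sup>2 > 0" using assms by (simp add: power_less_one_iff abs_square_less_1)
  have "(\<lambda>N. exp (- (exp (ln (real N) * (1 - a\<^sup>2) - a * sqrt (2 * ln (real N)) - 1 / 2) / sqrt (2 * pi)))) \<longlonglongrightarrow> 0"
    using a2 assms by real_asymp
  moreover have "\<forall>\<^sub>F N in sequentially.
      exp (- (exp (ln (real N) * (1 - a\<^sup>2) - a * sqrt (2 * ln (real N)) - 1 / 2) / sqrt (2 * pi))) =
      exp (- (real N * (exp (- (a * sqrt (2 * ln (real N)) + 1)\<^sup>2 / 2) / sqrt (2 * pi))))"
    using eventually_ge_at_top[of 1]
  proof eventually_elim
    case (elim N)
    define L where "L = sqrt (2 * ln (real N))"
    have L: "L\<^sup>2 = 2 * ln N" using elim by (simp add: L_def)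
    have "ln N * (1 - a\<^sup>2) - a * L - 1 / 2 = ln N + - (a * L + 1)\<^sup>2 / 2"
      by (simp add: power2_sum power_mult_distrib L field_simps)
    then have "exp (ln N * (1 - a\<^sup>2) - a * L - 1 / 2) = N * exp (- (a * L + 1)\<^sup>2 / 2)"
      using elim by (simp only: exp_add) simp
    then show ?case by (simp add: L_def)
  qed
  ultimately show ?thesis by (rule Lim_transform_eventually)
qed

text \<open>The square of 11/10 exceeds 1: the union bound is of order \<open>N\<close> to the power
  -21/100.\<close>

lemma gaussian_maximum_upper_tendsto:
  "(\<lambda>N. real N * (2 * exp (- (11 / 10 * sqrt (2 * ln (real N)))\<^sup>2 / 2))) \<longlonglongrightarrow> 0"
proof -
  have "(\<lambda>N. 2 * real N * exp (- 121 / 100 * ln (real N))) \<longlonglongrightarrow> 0"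
    by real_asymp
  moreover have "\<forall>\<^sub>F N in sequentially. 2 * real N * exp (- 121 / 100 * ln (real N)) =
      real N * (2 * exp (- (11 / 10 * sqrt (2 * ln (real N)))\<^sup>2 / 2))"
    using eventually_ge_at_top[of 1]
    by eventually_elim (simp add: power_mult_distrib power_divide)
  ultimately show ?thesis by (rule Lim_transform_eventually)
qed

section \<open>The synchronization probability\<close>

text \<open>Synchrony bounds the co-rotating frequencies by \<open>\<delta> * L\<close>. Unless the
  sum of squares is large, the mean is below \<open>(a - \<delta>) * L\<close>, so every frequency
  is at most \<open>a * L\<close>. Both alternatives are improbable.\<close>

lemma P_sync_le:
  assumes "prob_space M" and N: "N \<ge> 2"
    and indep: "prob_space.indep_vars M (\<lambda>i. borel) X {..<N}"
    and X: "\<And>i. i < N \<Longrightarrow> distributed M lborel (X i) std_normal_density"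
    and \<delta>: "0 < \<delta>" "\<delta> < a"
  defines "L \<equiv> sqrt (2 * ln N)"
  shows "P_sync M X (\<delta> * \<phi> N) N \<le>
    exp (- (N * (exp (- (a * L + 1)\<^sup>2 / 2) / sqrt (2 * pi)))) + 1 / ((a - \<delta>)\<^sup>2 * (2 * ln N))"
proof -
  interpret prob_space M by fact
  have L: "L > 0" "L\<^sup>2 = 2 * ln N" using N by (auto simp: L_def)
  have [measurable]: "X i \<in> borel_measurable M" if "i < N" for i
    using distributed_measurable[OF X[OF that]] by simp
  let ?A = "{x \<in> space M. \<forall>i<N. X i x \<le> a * L}"
  let ?B = "{x \<in> space M. ((a - \<delta>) * L)\<^sup>2 * N \<le> (\<Sum>i<N. (X i x)\<^sup>2)}"
  have meas: "?A \<in> events" "?B \<in> events" by measurable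
  have sub: "{x \<in> space M. has_fully_synchronous_solution N (\<delta> * \<phi> N) (\<lambda>i. X i x)} \<subseteq> ?A \<union> ?B"
  proof safe
    fix x i
    assume x: "x \<in> space M" "has_fully_synchronous_solution N (\<delta> * \<phi> N) (\<lambda>i. X i x)" and i: "i < N"
      and "\<not> ((a - \<delta>) * L)\<^sup>2 * N \<le> (\<Sum>i<N. (X i x)\<^sup>2)"
    then have "\<bar>(\<Sum>i<N. X i x) / N\<bar> < (a - \<delta>) * L"
      using \<delta> L N by (intro mean_less) auto
    moreover have "co_rotating N (\<lambda>i. X i x) i \<le> \<delta> * \<phi> N * N"
      using \<delta> L i by (intro has_fully_synchronous_solutionD[OF x(2)]) (auto simp: \<phi>_def L_def)
    moreover have "\<delta> * \<phi> N * N \<le> \<delta> * L"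
      using \<delta> L N by (simp add: \<phi>_def L_def[symmetric] field_simps)
    ultimately show "X i x \<le> a * L"
      unfolding co_rotating_def left_diff_distrib by linarith
  qed
  have "P_sync M X (\<delta> * \<phi> N) N \<le> prob (?A \<union> ?B)"
    unfolding P_sync_def using sub meas by (intro finite_measure_mono) auto
  also have "\<dots> \<le> prob ?A + prob ?B"
    using meas by (rule measure_Un_le)
  also have "prob ?A \<le> exp (- (N * (exp (- (a * L + 1)\<^sup>2 / 2) / sqrt (2 * pi))))"
    using N L \<delta> by (intro indep_std_normal_all_le indep X) auto
  also have "prob ?B \<le> real (card {..<N}) / (((a - \<delta>) * L)\<^sup>2 * N)"
    using N L \<delta> by (intro sum_squares_std_normal_tail_le X) auto
  also have "\<dots> = 1 / ((a - \<delta>)\<^sup>2 * (2 * ln N))"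
    using N by (simp add: power_mult_distrib L)
  finally show ?thesis by simp
qed

lemma P_sync_ge:
  assumes "prob_space M" and N: "N \<ge> 24"
    and X: "\<And>i. i < N \<Longrightarrow> distributed M lborel (X i) std_normal_density"
    and \<delta>: "\<delta> \<ge> 2"
  defines "L \<equiv> sqrt (2 * ln N)"
  shows "P_sync M X (\<delta> * \<phi> N) N \<ge> 1 - (N * (2 * exp (- (11 / 10 * L)\<^sup>2 / 2)) + 200 / ln N)"
proof -
  interpret prob_space M by fact
  have L: "L > 0" "L\<^sup>2 = 2 * ln N" using N by (auto simp: L_def)
  have [measurable]: "X i \<in> borel_measurable M" if "i < N" for i
    using distributed_measurable[OF X[OF that]] by simp
  let ?S = "{x \<in> space M. has_fully_synchronous_solution N (\<delta> * \<phi> N) (\<lambda>i. X i x)}"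
  let ?A = "\<Union>i<N. {x \<in> space M. 11 / 10 * L \<le> \<bar>X i x\<bar>}"
  let ?B = "{x \<in> space M. (L / 20)\<^sup>2 * N \<le> (\<Sum>i<N. (X i x)\<^sup>2)}"
  have meas: "?A \<in> events" "?B \<in> events" by measurable
  have S: "?S \<in> events"
    using N by (intro sets_has_fully_synchronous_solution) auto
  \<comment> \<open>The bound \<open>N \<ge> 24\<close> makes \<open>N / (N + 1)\<close> at least
    24/25.\<close>
  have \<gamma>: "\<delta> * \<phi> N * N \<ge> 48 / 25 * L"
  proof -
    have "24 / 25 \<le> N / (real N + 1)" using N by (simp add: field_simps)
    then have "2 * (24 / 25) * L \<le> \<delta> * (N / (real N + 1)) * L"
      using \<delta> L by (intro mult_right_mono mult_mono) auto
    then show ?thesis by (simp add: \<phi>_def L_def mult_ac)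
  qed
  have "space M - ?S \<subseteq> ?A \<union> ?B"
  proof (rule subsetI, rule ccontr)
    fix x assume x: "x \<in> space M - ?S" "x \<notin> ?A \<union> ?B"
    have A: "\<bar>X i x\<bar> < 11 / 10 * L" if "i < N" for i
    proof -
      have "x \<notin> {x \<in> space M. 11 / 10 * L \<le> \<bar>X i x\<bar>}"
        using x(2) that by blast
      then show ?thesis
        using x(1) by (simp add: not_le)
    qed
    have B: "(\<Sum>i<N. (X i x)\<^sup>2) < (L / 20)\<^sup>2 * N" using x by auto
    then have mean: "\<bar>(\<Sum>i<N. X i x) / N\<bar> < L / 20"
      using L N by (intro mean_less) auto
    have "has_fully_synchronous_solution N (\<delta> * \<phi> N) (\<lambda>i. X i x)"
    proof (rule has_fully_synchronous_solutionI)
      show "\<delta> * \<phi> N > 0" using \<delta> N by (simp add: \<phi>_def)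
      \<comment> \<open>A frequency and the mean contribute at most 11/10 + 1/20 = 1.15 times
        \<open>L\<close>, just below 3/5 * 48/25 = 1.152.\<close>
      show "\<bar>co_rotating N (\<lambda>i. X i x) i\<bar> \<le> 3 / 5 * (\<delta> * \<phi> N * N)" if "i < N" for i
        using A[OF that] mean \<gamma> L(1) unfolding co_rotating_def by linarith
      have "(\<Sum>i<N. (co_rotating N (\<lambda>i. X i x) i)\<^sup>2) \<le> (\<Sum>i<N. (X i x)\<^sup>2)"
        using N by (simp add: sum_co_rotating_squares)
      also have "\<dots> \<le> (L / 20)\<^sup>2 * N" using B by simp
      also have "\<dots> \<le> 2 / 25 * (48 / 25 * L)\<^sup>2 * N"
        by (intro mult_right_mono) (auto simp: power2_eq_square)
      also have "\<dots> \<le> 2 / 25 * (\<delta> * \<phi> N * N)\<^sup>2 * N"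
        using \<gamma> L by (intro mult_right_mono mult_left_mono power_mono) auto
      finally show "(\<Sum>i<N. (co_rotating N (\<lambda>i. X i x) i)\<^sup>2) \<le> 2 / 25 * (\<delta> * \<phi> N * N)\<^sup>2 * N" .
    qed (use N in auto)
    then show False using x by auto
  qed
  then have "prob (space M - ?S) \<le> prob (?A \<union> ?B)"
    using meas by (intro finite_measure_mono) auto
  also have "\<dots> \<le> prob ?A + prob ?B"
    using meas by (rule measure_Un_le)
  also have "prob ?A \<le> (\<Sum>i<N. prob {x \<in> space M. 11 / 10 * L \<le> \<bar>X i x\<bar>})"
    by (intro finite_measure_subadditive_finite) auto
  also have "\<dots> \<le> (\<Sum>i<N. 2 * exp (- (11 / 10 * L)\<^sup>2 / 2))"
    using L by (intro sum_mono std_normal_tail_le X) auto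
  also have "\<dots> = N * (2 * exp (- (11 / 10 * L)\<^sup>2 / 2))" by simp
  also have "prob ?B \<le> real (card {..<N}) / ((L / 20)\<^sup>2 * N)"
    using N L by (intro sum_squares_std_normal_tail_le X) auto
  also have "\<dots> = 200 / ln N"
    using N by (simp add: power_divide L)
  finally show ?thesis
    using prob_compl[OF S] by (simp add: P_sync_def)
qed

theorem theorem4p1:
  fixes M :: "nat \<Rightarrow> 'a measure"
    and \<omega> :: "nat \<Rightarrow> nat \<Rightarrow> 'a \<Rightarrow> real"
    and \<delta> :: real
  assumes "\<And>N. N \<ge> 1 \<Longrightarrow> prob_space (M N)"
    and "\<And>N. N \<ge> 1 \<Longrightarrow> prob_space.indep_vars (M N) (\<lambda>i. borel) (\<omega> N) {..<N}"
    and "\<And>N i. N \<ge> 1 \<Longrightarrow> i < N \<Longrightarrow>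
           distributed (M N) lborel (\<omega> N i) (normal_density 0 1)"
    and "\<delta> > 0"
  shows "(\<delta> < 1 \<longrightarrow> (\<lambda>N. P_sync (M N) (\<omega> N) (\<delta> * \<phi> N) N) \<longlonglongrightarrow> 0) \<and>
         (\<delta> \<ge> 2 \<longrightarrow> (\<lambda>N. P_sync (M N) (\<omega> N) (\<delta> * \<phi> N) N) \<longlonglongrightarrow> 1)"
proof (intro conjI impI)
  assume "\<delta> < 1"
  \<comment> \<open>The gap from \<open>a\<close> to 1 lets the maximum exceed \<open>a * L\<close>;
    the gap from \<delta> to \<open>a\<close> absorbs the mean.\<close>
  define a where "a = (1 + \<delta>) / 2"
  have a: "0 < a" "a < 1" "\<delta> < a" using \<open>\<delta> < 1\<close> \<open>\<delta> > 0\<close> by (auto simp: a_def)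
  have "(\<lambda>N. 1 / ((a - \<delta>)\<^sup>2 * (2 * ln (real N)))) \<longlonglongrightarrow> 0"
    using a by real_asymp
  from tendsto_add[OF gaussian_maximum_lower_tendsto[OF a(1,2)] this]
  have lim: "(\<lambda>N. exp (- (N * (exp (- (a * sqrt (2 * ln N) + 1)\<^sup>2 / 2) / sqrt (2 * pi)))) +
      1 / ((a - \<delta>)\<^sup>2 * (2 * ln N))) \<longlonglongrightarrow> 0" by simp
  show "(\<lambda>N. P_sync (M N) (\<omega> N) (\<delta> * \<phi> N) N) \<longlonglongrightarrow> 0"
  proof (rule tendsto_sandwich[OF _ _ tendsto_const lim])
    show "\<forall>\<^sub>F N in sequentially. 0 \<le> P_sync (M N) (\<omega> N) (\<delta> * \<phi> N) N"
      by (simp add: P_sync_def)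
    show "\<forall>\<^sub>F N in sequentially. P_sync (M N) (\<omega> N) (\<delta> * \<phi> N) N \<le>
        exp (- (N * (exp (- (a * sqrt (2 * ln N) + 1)\<^sup>2 / 2) / sqrt (2 * pi)))) + 1 / ((a - \<delta>)\<^sup>2 * (2 * ln N))"
      using eventually_ge_at_top[of 2]
    proof eventually_elim
      case (elim N)
      with assms a show ?case by (intro P_sync_le) auto
    qed
  qed
next
  assume \<delta>: "\<delta> \<ge> 2"
  have "(\<lambda>N. 200 / ln (real N)) \<longlonglongrightarrow> 0" by real_asymp
  from tendsto_diff[OF tendsto_const[of 1] tendsto_add[OF gaussian_maximum_upper_tendsto this]]
  have lim: "(\<lambda>N. 1 - (N * (2 * exp (- (11 / 10 * sqrt (2 * ln N))\<^sup>2 / 2)) + 200 / ln N)) \<longlonglongrightarrow> 1"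
    by simp
  show "(\<lambda>N. P_sync (M N) (\<omega> N) (\<delta> * \<phi> N) N) \<longlonglongrightarrow> 1"
  proof (rule tendsto_sandwich[OF _ _ lim tendsto_const])
    show "\<forall>\<^sub>F N in sequentially. 1 - (N * (2 * exp (- (11 / 10 * sqrt (2 * ln N))\<^sup>2 / 2)) + 200 / ln N) \<le>
        P_sync (M N) (\<omega> N) (\<delta> * \<phi> N) N"
      using eventually_ge_at_top[of 24]
    proof eventually_elim
      case (elim N)
      with assms \<delta> show ?case by (intro P_sync_ge) auto
    qed
    show "\<forall>\<^sub>F N in sequentially. P_sync (M N) (\<omega> N) (\<delta> * \<phi> N) N \<le> 1"
      using eventually_ge_at_top[of 1]
    proof eventually_elim
      case (elim N)
      then interpret prob_space "M N" using assms(1) by blast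
      show ?case by (simp add: P_sync_def)
    qed
  qed
qed

end
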